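(* Let $R$ be a ring and $M$ a left $R$-module. Let $\mathrm{wLoc}(M)$ be the sum of all w-local submodules of $M$ and let $\mathrm{cgs}(M)$ be the sum of all cofinitely Rad-supplemented submodules of $M$. The following statements are equivalent: (a) $M$ is cofinitely Rad-supplemented; (b) every maximal submodule of $M$ has a Rad-supplement in $M$; (c) $M/\mathrm{wLoc}(M)$ has no maximal submodules; (d) $M/\mathrm{cgs}(M)$ has no maximal submodules.
   Context: All rings are associative with identity and all modules are unital left modules. $\mathrm{Rad}(L)$ denotes the radical of a module $L$: the intersection of all maximal submodules of $L$, or $L$ itself if $L$ has no maximal submodules. For submodules $N, L$ of a module $M$, $L$ is called a Rad-supplement of $N$ in $M$ if $N+L=M$ and $N\cap L\subseteq \mathrm{Rad}(L)$. A submodule $N$ of $M$ is cofinite if $M/N$ is finitely generated. A module $M$ is cofinitely Rad-supplemented if every cofinite submodule of $M$ has a Rad-supplement in $M$. A module is w-local if it has a unique maximal submodule. An empty sum of submodules is the zero submodule. *)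

theory Defs
  imports "HOL.Hull" "HOL-Algebra.AbelCoset" "HOL-Algebra.Module"
begin

text \<open>
  The locale \<open>module\<close> of HOL-Algebra requires a commutative ring of scalars. The locale below has
  the same axioms over an arbitrary associative ring with identity. The locale \<open>submodule\<close> makes no
  commutativity assumption and is used as it is. A submodule \<open>L\<close> of \<open>M\<close>, regarded as a module in
  its own right, is the record \<open>M\<lparr>carrier := L\<rparr>\<close>.
\<close>

locale left_module = R?: ring R + M?: abelian_group M
  for R :: "('a, 'c) ring_scheme" (structure) and M :: "('a, 'b, 'm) module_scheme" (structure) +
  assumes smult_closed [simp, intro]:
      "\<lbrakk>a \<in> carrier R; x \<in> carrier M\<rbrakk> \<Longrightarrow> a \<odot>\<^bsub>M\<^esub> x \<in> carrier M"
    and smult_l_distr: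
      "\<lbrakk>a \<in> carrier R; b \<in> carrier R; x \<in> carrier M\<rbrakk> \<Longrightarrow>
        (a \<oplus>\<^bsub>R\<^esub> b) \<odot>\<^bsub>M\<^esub> x = a \<odot>\<^bsub>M\<^esub> x \<oplus>\<^bsub>M\<^esub> b \<odot>\<^bsub>M\<^esub> x"
    and smult_r_distr:
      "\<lbrakk>a \<in> carrier R; x \<in> carrier M; y \<in> carrier M\<rbrakk> \<Longrightarrow>
        a \<odot>\<^bsub>M\<^esub> (x \<oplus>\<^bsub>M\<^esub> y) = a \<odot>\<^bsub>M\<^esub> x \<oplus>\<^bsub>M\<^esub> a \<odot>\<^bsub>M\<^esub> y"
    and smult_assoc1:
      "\<lbrakk>a \<in> carrier R; b \<in> carrier R; x \<in> carrier M\<rbrakk> \<Longrightarrow>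
        (a \<otimes>\<^bsub>R\<^esub> b) \<odot>\<^bsub>M\<^esub> x = a \<odot>\<^bsub>M\<^esub> (b \<odot>\<^bsub>M\<^esub> x)"
    and smult_one [simp]:
      "x \<in> carrier M \<Longrightarrow> \<one>\<^bsub>R\<^esub> \<odot>\<^bsub>M\<^esub> x = x"

text \<open>
  The fields \<open>mult\<close> and \<open>one\<close> of a module record carry no information and are left undefined in the
  quotient. As for \<open>rcoset_mult\<close> in factor rings, the union defining the scalar multiple
  of a coset \<open>X\<close> is the single coset \<open>N +>\<^bsub>M\<^esub> (r \<odot>\<^bsub>M\<^esub> x)\<close>, for any \<open>x\<close> in \<open>X\<close>.
\<close>

definition quotient_module ::
    "('a, 'b, 'm) module_scheme \<Rightarrow> 'b set \<Rightarrow> ('a, 'b set) module" where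
  "quotient_module M N =
    \<lparr>carrier = a_rcosets\<^bsub>M\<^esub> N, mult = undefined, one = undefined,
     zero = N, add = set_add M,
     smult = (\<lambda>r X. \<Union>x\<in>X. N +>\<^bsub>M\<^esub> (r \<odot>\<^bsub>M\<^esub> x))\<rparr>"

definition maximal_submodule ::
    "('a, 'c) ring_scheme \<Rightarrow> ('a, 'b, 'm) module_scheme \<Rightarrow> 'b set \<Rightarrow> bool" where
  "maximal_submodule R M N \<longleftrightarrow>
    submodule N R M \<and> N \<noteq> carrier M \<and>
    (\<forall>L. submodule L R M \<longrightarrow> N \<subseteq> L \<longrightarrow> L = N \<or> L = carrier M)"

definition Rad :: "('a, 'c) ring_scheme \<Rightarrow> ('a, 'b, 'm) module_scheme \<Rightarrow> 'b set" where
  "Rad R M =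
    (if \<exists>N. maximal_submodule R M N then \<Inter>{N. maximal_submodule R M N} else carrier M)"

definition Rad_supplement ::
    "('a, 'c) ring_scheme \<Rightarrow> ('a, 'b, 'm) module_scheme \<Rightarrow> 'b set \<Rightarrow> 'b set \<Rightarrow> bool" where
  "Rad_supplement R M N L \<longleftrightarrow>
    submodule L R M \<and> N <+>\<^bsub>M\<^esub> L = carrier M \<and> N \<inter> L \<subseteq> Rad R (M\<lparr>carrier := L\<rparr>)"

definition finitely_generated ::
    "('a, 'c) ring_scheme \<Rightarrow> ('a, 'b, 'm) module_scheme \<Rightarrow> bool" where
  "finitely_generated R M \<longleftrightarrow>
    (\<exists>S. finite S \<and> S \<subseteq> carrier M \<and> (\<lambda>H. submodule H R M) hull S = carrier M)"

definition cofinite_submodule ::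
    "('a, 'c) ring_scheme \<Rightarrow> ('a, 'b, 'm) module_scheme \<Rightarrow> 'b set \<Rightarrow> bool" where
  "cofinite_submodule R M N \<longleftrightarrow>
    submodule N R M \<and> finitely_generated R (quotient_module M N)"

definition cofinitely_Rad_supplemented ::
    "('a, 'c) ring_scheme \<Rightarrow> ('a, 'b, 'm) module_scheme \<Rightarrow> bool" where
  "cofinitely_Rad_supplemented R M \<longleftrightarrow>
    (\<forall>N. cofinite_submodule R M N \<longrightarrow> (\<exists>L. Rad_supplement R M N L))"

definition w_local :: "('a, 'c) ring_scheme \<Rightarrow> ('a, 'b, 'm) module_scheme \<Rightarrow> bool" where
  "w_local R M \<longleftrightarrow> (\<exists>!N. maximal_submodule R M N)"

text \<open>
  The sum of a family of submodules consists of all finite sums of elements of its members. The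
  sum of the empty family is the zero submodule, since \<open>finsum M f {} = \<zero>\<^bsub>M\<^esub>\<close>.
\<close>

definition submodule_sum :: "('a, 'b, 'm) module_scheme \<Rightarrow> 'b set set \<Rightarrow> 'b set" where
  "submodule_sum M \<F> =
    {finsum M f \<G> | f \<G>. finite \<G> \<and> \<G> \<subseteq> \<F> \<and> (\<forall>L\<in>\<G>. f L \<in> L)}"

definition wLoc :: "('a, 'c) ring_scheme \<Rightarrow> ('a, 'b, 'm) module_scheme \<Rightarrow> 'b set" where
  "wLoc R M = submodule_sum M {L. submodule L R M \<and> w_local R (M\<lparr>carrier := L\<rparr>)}"

definition cgs :: "('a, 'c) ring_scheme \<Rightarrow> ('a, 'b, 'm) module_scheme \<Rightarrow> 'b set" where
  "cgs R M =
    submodule_sum M {L. submodule L R M \<and> cofinitely_Rad_supplemented R (M\<lparr>carrier := L\<rparr>)}"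

end

theory Submission
  imports Defs
begin

text \<open>
  A maximal submodule of a quotient \<open>M/W\<close> is the same thing as a maximal submodule of \<open>M\<close> that
  contains \<open>W\<close> (\<open>maximal_quotient_iff\<close>). The last two statements therefore say that no
  maximal submodule of \<open>M\<close> contains \<open>wLoc(M)\<close>, respectively \<open>cgs(M)\<close>, and the four statements are
  proved equivalent in a circle.
  
  Maximal submodules are cofinite, so (a) implies (b). If \<open>L\<close> is a Rad-supplement of a maximal
  submodule \<open>N\<close>, then \<open>N \<inter> L\<close> is maximal in \<open>L\<close> by the second isomorphism theorem and lies in
  \<open>Rad(L)\<close>, hence in every maximal submodule of \<open>L\<close>. So it is the only one, and \<open>L\<close> is w-local. As
  \<open>L\<close> is contained in \<open>wLoc(M)\<close> but not in \<open>N\<close>, the submodule \<open>N\<close> does not contain \<open>wLoc(M)\<close>: this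
  is (b) implies (c). A w-local module is cofinitely Rad-supplemented, because a proper cofinite
  submodule lies in the unique maximal submodule, which is the radical, and so has the whole module
  as a Rad-supplement. Hence \<open>wLoc(M) \<subseteq> cgs(M)\<close>, and (c) implies (d).
  
  For (d) implies (a), let \<open>N\<close> be cofinite. A proper cofinite submodule lies in a maximal one by
  Zorn's lemma, so (d) forces \<open>N + cgs(M) = M\<close>, and since \<open>M/N\<close> is finitely generated, finitely many
  cofinitely Rad-supplemented submodules already satisfy \<open>N + U\<^sub>1 + \<dots> + U\<^sub>n = M\<close>. The
  submodule \<open>M\<close> has the Rad-supplement \<open>0\<close>, and the \<open>U\<^sub>i\<close> can be removed one at a time by
  \<open>Rad_supplement_step\<close>: a Rad-supplement of \<open>N + U\<close> gives one of \<open>N\<close>.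
\<close>

section \<open>Submodules\<close>

context left_module
begin

lemma smult_zero [simp]:
  assumes a: "a \<in> carrier R" shows "a \<odot>\<^bsub>M\<^esub> \<zero>\<^bsub>M\<^esub> = \<zero>\<^bsub>M\<^esub>"
proof -
  have "a \<odot>\<^bsub>M\<^esub> \<zero>\<^bsub>M\<^esub> \<oplus>\<^bsub>M\<^esub> a \<odot>\<^bsub>M\<^esub> \<zero>\<^bsub>M\<^esub> = a \<odot>\<^bsub>M\<^esub> \<zero>\<^bsub>M\<^esub>"
    using smult_r_distr[OF a, of "\<zero>\<^bsub>M\<^esub>" "\<zero>\<^bsub>M\<^esub>"] by simp
  then show ?thesis
    using a by (metis M.add.l_cancel_one M.zero_closed smult_closed)
qed

lemma zero_smult [simp]:
  assumes x: "x \<in> carrier M" shows "\<zero>\<^bsub>R\<^esub> \<odot>\<^bsub>M\<^esub> x = \<zero>\<^bsub>M\<^esub>"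
proof -
  have "\<zero>\<^bsub>R\<^esub> \<odot>\<^bsub>M\<^esub> x \<oplus>\<^bsub>M\<^esub> \<zero>\<^bsub>R\<^esub> \<odot>\<^bsub>M\<^esub> x = \<zero>\<^bsub>R\<^esub> \<odot>\<^bsub>M\<^esub> x"
    using smult_l_distr[of "\<zero>\<^bsub>R\<^esub>" "\<zero>\<^bsub>R\<^esub>" x] x by simp
  then show ?thesis
    using x by (metis M.add.l_cancel_one R.zero_closed smult_closed)
qed

lemma minus_one_smult:
  assumes x: "x \<in> carrier M" shows "(\<ominus>\<^bsub>R\<^esub> \<one>\<^bsub>R\<^esub>) \<odot>\<^bsub>M\<^esub> x = \<ominus>\<^bsub>M\<^esub> x"
proof -
  have "(\<ominus>\<^bsub>R\<^esub> \<one>\<^bsub>R\<^esub>) \<odot>\<^bsub>M\<^esub> x \<oplus>\<^bsub>M\<^esub> x = \<zero>\<^bsub>M\<^esub>"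
    using smult_l_distr[of "\<ominus>\<^bsub>R\<^esub> \<one>\<^bsub>R\<^esub>" "\<one>\<^bsub>R\<^esub>" x] x by (simp add: R.l_neg)
  then show ?thesis
    using x by (metis M.minus_equality R.a_inv_closed R.one_closed smult_closed)
qed

text \<open>
  Closure under negation follows from closure under multiplication by \<open>-1\<close>. Leaving \<open>a_inv\<close> out
  matters for the restricted record \<open>M\<lparr>carrier := L\<rparr>\<close> and the quotient record, where \<open>a_inv\<close>
  is a definite description over a different carrier, whereas the operations named here are the
  explicit record fields.
\<close>

lemma submodule_iff:
  "submodule H R M \<longleftrightarrow>
    H \<subseteq> carrier M \<and> \<zero>\<^bsub>M\<^esub> \<in> H \<and> (\<forall>x\<in>H. \<forall>y\<in>H. x \<oplus>\<^bsub>M\<^esub> y \<in> H) \<and>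
    (\<forall>a\<in>carrier R. \<forall>x\<in>H. a \<odot>\<^bsub>M\<^esub> x \<in> H)"
proof
  assume H: "submodule H R M"
  interpret submodule H R M by (rule H)
  show "H \<subseteq> carrier M \<and> \<zero>\<^bsub>M\<^esub> \<in> H \<and> (\<forall>x\<in>H. \<forall>y\<in>H. x \<oplus>\<^bsub>M\<^esub> y \<in> H) \<and>
    (\<forall>a\<in>carrier R. \<forall>x\<in>H. a \<odot>\<^bsub>M\<^esub> x \<in> H)"
    using subset one_closed m_closed smult_closed by auto
next
  assume H: "H \<subseteq> carrier M \<and> \<zero>\<^bsub>M\<^esub> \<in> H \<and> (\<forall>x\<in>H. \<forall>y\<in>H. x \<oplus>\<^bsub>M\<^esub> y \<in> H) \<and>
    (\<forall>a\<in>carrier R. \<forall>x\<in>H. a \<odot>\<^bsub>M\<^esub> x \<in> H)"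
  have "\<ominus>\<^bsub>M\<^esub> x \<in> H" if "x \<in> H" for x
    using H that minus_one_smult[of x] by (metis R.a_inv_closed R.one_closed subset_iff)
  then show "submodule H R M"
    using H by unfold_locales (auto simp flip: a_inv_def)
qed

lemma submoduleD:
  assumes "submodule H R M"
  shows submodule_subset: "H \<subseteq> carrier M"
    and submodule_zero: "\<zero>\<^bsub>M\<^esub> \<in> H"
    and submodule_add: "\<And>x y. x \<in> H \<Longrightarrow> y \<in> H \<Longrightarrow> x \<oplus>\<^bsub>M\<^esub> y \<in> H"
    and submodule_smult: "\<And>a x. a \<in> carrier R \<Longrightarrow> x \<in> H \<Longrightarrow> a \<odot>\<^bsub>M\<^esub> x \<in> H"
    and submodule_minus: "\<And>x. x \<in> H \<Longrightarrow> \<ominus>\<^bsub>M\<^esub> x \<in> H"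
  using assms submodule_iff submodule.axioms(1)[OF assms, THEN subgroup.m_inv_closed]
  by (auto simp: a_inv_def)

lemma submodule_add_cancel:
  assumes "submodule H R M" "x \<in> carrier M" "y \<in> H" "x \<oplus>\<^bsub>M\<^esub> y \<in> H"
  shows "x \<in> H"
proof -
  have "y \<in> carrier M" using assms submodule_subset by blast
  then have "x = (x \<oplus>\<^bsub>M\<^esub> y) \<oplus>\<^bsub>M\<^esub> \<ominus>\<^bsub>M\<^esub> y"
    using assms(2) by (simp add: M.a_assoc M.r_neg)
  then show ?thesis
    using assms submodule_add submodule_minus by metis
qed

lemma submodule_add_cancel':
  assumes "submodule H R M" "x \<in> carrier M" "y \<in> H" "y \<oplus>\<^bsub>M\<^esub> x \<in> H"
  shows "x \<in> H"
  using assms submodule_add_cancel M.a_comm submodule_subset by (metis subset_iff)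

lemma carrier_submodule: "submodule (carrier M) R M"
  by (auto simp: submodule_iff)

lemma zero_submodule: "submodule {\<zero>\<^bsub>M\<^esub>} R M"
  by (auto simp: submodule_iff)

lemma submodule_Int:
  "submodule H R M \<Longrightarrow> submodule K R M \<Longrightarrow> submodule (H \<inter> K) R M"
  by (auto simp: submodule_iff)

lemma mem_set_add: "x \<in> H <+>\<^bsub>M\<^esub> K \<longleftrightarrow> (\<exists>h\<in>H. \<exists>k\<in>K. x = h \<oplus>\<^bsub>M\<^esub> k)"
  by (auto simp: set_add_def')

lemma submodule_set_add:
  assumes H: "submodule H R M" and K: "submodule K R M"
  shows "submodule (H <+>\<^bsub>M\<^esub> K) R M"
  unfolding submodule_iff
proof (intro conjI ballI)
  note sub = submodule_subset[OF H, THEN subsetD] submodule_subset[OF K, THEN subsetD]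
  show "H <+>\<^bsub>M\<^esub> K \<subseteq> carrier M"
    using sub by (auto simp: mem_set_add)
  show "\<zero>\<^bsub>M\<^esub> \<in> H <+>\<^bsub>M\<^esub> K"
    using submodule_zero[OF H] submodule_zero[OF K] by (force simp: mem_set_add)
  show "a \<odot>\<^bsub>M\<^esub> x \<in> H <+>\<^bsub>M\<^esub> K" if "a \<in> carrier R" "x \<in> H <+>\<^bsub>M\<^esub> K" for a x
    using that sub smult_r_distr submodule_smult[OF H] submodule_smult[OF K]
    unfolding mem_set_add by metis
  fix x y assume "x \<in> H <+>\<^bsub>M\<^esub> K" "y \<in> H <+>\<^bsub>M\<^esub> K"
  then obtain h k h' k' where hk: "h \<in> H" "k \<in> K" "h' \<in> H" "k' \<in> K"
    and xy: "x = h \<oplus>\<^bsub>M\<^esub> k" "y = h' \<oplus>\<^bsub>M\<^esub> k'"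
    unfolding mem_set_add by blast
  have "x \<oplus>\<^bsub>M\<^esub> y = (h \<oplus>\<^bsub>M\<^esub> h') \<oplus>\<^bsub>M\<^esub> (k \<oplus>\<^bsub>M\<^esub> k')"
    using hk sub unfolding xy by (simp add: M.a_ac)
  then show "x \<oplus>\<^bsub>M\<^esub> y \<in> H <+>\<^bsub>M\<^esub> K"
    using hk submodule_add[OF H] submodule_add[OF K] unfolding mem_set_add by blast
qed

lemma set_add_upper1:
  assumes "submodule H R M" "submodule K R M" shows "H \<subseteq> H <+>\<^bsub>M\<^esub> K"
proof
  fix x assume x: "x \<in> H"
  have "x = x \<oplus>\<^bsub>M\<^esub> \<zero>\<^bsub>M\<^esub>" using x assms submodule_subset by fastforce
  then show "x \<in> H <+>\<^bsub>M\<^esub> K" unfolding mem_set_add using x submodule_zero[OF assms(2)] by blast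
qed

lemma set_add_upper2:
  assumes "submodule H R M" "submodule K R M" shows "K \<subseteq> H <+>\<^bsub>M\<^esub> K"
proof
  fix x assume x: "x \<in> K"
  have "x = \<zero>\<^bsub>M\<^esub> \<oplus>\<^bsub>M\<^esub> x" using x assms submodule_subset by fastforce
  then show "x \<in> H <+>\<^bsub>M\<^esub> K" unfolding mem_set_add using x submodule_zero[OF assms(1)] by blast
qed

lemma left_module_submodule:
  assumes L: "submodule L R M"
  shows "left_module R (M\<lparr>carrier := L\<rparr>)"
proof -
  note sub = submodule_subset[OF L, THEN subsetD]
  have neg: "\<exists>y\<in>L. y \<oplus>\<^bsub>M\<^esub> x = \<zero>\<^bsub>M\<^esub>" if "x \<in> L" for x
    using that submodule_minus[OF L] sub M.l_neg by blast
  have "abelian_group (M\<lparr>carrier := L\<rparr>)"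
    using neg by (intro abelian_groupI)
      (auto simp: sub M.a_ac submodule_zero[OF L] submodule_add[OF L])
  then show ?thesis
    by (intro left_module.intro R.ring_axioms left_module_axioms.intro)
      (auto simp: sub smult_l_distr smult_r_distr smult_assoc1 submodule_smult[OF L])
qed

text \<open>
  Statements about \<open>L\<close> as a module in its own right are translated by this equivalence into
  statements about submodules of \<open>M\<close>.
\<close>

lemma submodule_restrict_iff:
  assumes L: "submodule L R M"
  shows "submodule K R (M\<lparr>carrier := L\<rparr>) \<longleftrightarrow> submodule K R M \<and> K \<subseteq> L"
  using submodule_subset[OF L]
  by (auto simp: submodule_iff left_module.submodule_iff[OF left_module_submodule[OF L]])

end

lemma set_add_restrict [simp]: "set_add (M\<lparr>carrier := L\<rparr>) = set_add M"
  by (simp add: set_add_def' fun_eq_iff)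

section \<open>Quotient modules\<close>

context left_module
begin

context
  fixes W assumes W: "submodule W R M"
begin

interpretation W: abelian_subgroup W M
  by (intro abelian_subgroupI3 additive_subgroup.intro submodule.axioms(1)[OF W]
      M.abelian_group_axioms)

lemma coset_eq_iff:
  assumes "x \<in> carrier M" "y \<in> carrier M"
  shows "W +>\<^bsub>M\<^esub> x = W +>\<^bsub>M\<^esub> y \<longleftrightarrow> x \<oplus>\<^bsub>M\<^esub> \<ominus>\<^bsub>M\<^esub> y \<in> W"
  using assms W.a_rcos_module[of y x] W.a_rcos_self[of x] W.a_repr_independence'
  by metis

lemma carrier_quotient: "carrier (quotient_module M W) = (\<lambda>x. W +>\<^bsub>M\<^esub> x) ` carrier M"
  by (auto simp: quotient_module_def A_RCOSETS_def')

lemma zero_quotient: "\<zero>\<^bsub>quotient_module M W\<^esub> = W +>\<^bsub>M\<^esub> \<zero>\<^bsub>M\<^esub>"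
  using W.a_subset by (simp add: quotient_module_def)

lemma add_quotient:
  assumes "x \<in> carrier M" "y \<in> carrier M"
  shows "(W +>\<^bsub>M\<^esub> x) \<oplus>\<^bsub>quotient_module M W\<^esub> (W +>\<^bsub>M\<^esub> y) = W +>\<^bsub>M\<^esub> (x \<oplus>\<^bsub>M\<^esub> y)"
  using assms by (simp add: quotient_module_def W.a_rcos_sum)

lemma smult_quotient:
  assumes r: "r \<in> carrier R" and x: "x \<in> carrier M"
  shows "r \<odot>\<^bsub>quotient_module M W\<^esub> (W +>\<^bsub>M\<^esub> x) = W +>\<^bsub>M\<^esub> (r \<odot>\<^bsub>M\<^esub> x)"
proof -
  have "W +>\<^bsub>M\<^esub> (r \<odot>\<^bsub>M\<^esub> y) = W +>\<^bsub>M\<^esub> (r \<odot>\<^bsub>M\<^esub> x)" if y: "y \<in> W +>\<^bsub>M\<^esub> x" for y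
  proof -
    obtain w where w: "w \<in> W" "y = w \<oplus>\<^bsub>M\<^esub> x"
      using y by (auto simp: a_r_coset_def')
    have "r \<odot>\<^bsub>M\<^esub> w \<in> W" using submodule_smult[OF W r] w(1) by simp
    moreover have "r \<odot>\<^bsub>M\<^esub> y = r \<odot>\<^bsub>M\<^esub> w \<oplus>\<^bsub>M\<^esub> r \<odot>\<^bsub>M\<^esub> x"
      using w r x smult_r_distr by auto
    ultimately have "r \<odot>\<^bsub>M\<^esub> y \<in> W +>\<^bsub>M\<^esub> (r \<odot>\<^bsub>M\<^esub> x)"
      by (auto simp: a_r_coset_def')
    then show ?thesis
      using W.a_repr_independence' r x by (metis smult_closed)
  qed
  moreover have "x \<in> W +>\<^bsub>M\<^esub> x" using x W.a_rcos_self by blast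
  ultimately have "(\<Union>y\<in>W +>\<^bsub>M\<^esub> x. W +>\<^bsub>M\<^esub> (r \<odot>\<^bsub>M\<^esub> y)) = W +>\<^bsub>M\<^esub> (r \<odot>\<^bsub>M\<^esub> x)"
    by (intro SUP_eq_const) blast+
  then show ?thesis by (simp add: quotient_module_def)
qed

lemmas quotient_ops = carrier_quotient zero_quotient add_quotient smult_quotient

lemma left_module_quotient: "left_module R (quotient_module M W)"
proof -
  have neg: "\<exists>y\<in>carrier M. W +>\<^bsub>M\<^esub> (y \<oplus>\<^bsub>M\<^esub> x) = W +>\<^bsub>M\<^esub> \<zero>\<^bsub>M\<^esub>" if "x \<in> carrier M" for x
    using that M.l_neg M.a_inv_closed by metis
  have "abelian_group (quotient_module M W)"
    using neg by (intro abelian_groupI) (auto simp: quotient_ops M.a_ac)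
  then show ?thesis
    by (intro left_module.intro R.ring_axioms left_module_axioms.intro)
      (auto simp: quotient_ops smult_l_distr smult_r_distr smult_assoc1)
qed

interpretation Q: left_module R "quotient_module M W"
  by (rule left_module_quotient)

lemma submodule_image:
  assumes H: "submodule H R M"
  shows "submodule ((\<lambda>x. W +>\<^bsub>M\<^esub> x) ` H) R (quotient_module M W)"
proof -
  have "\<zero>\<^bsub>quotient_module M W\<^esub> \<in> (\<lambda>x. W +>\<^bsub>M\<^esub> x) ` H"
    unfolding zero_quotient using submodule_zero[OF H] by (rule imageI)
  then show ?thesis
    unfolding Q.submodule_iff
    using submodule_subset[OF H] submodule_add[OF H] submodule_smult[OF H]
    by (auto simp: carrier_quotient add_quotient smult_quotient subset_iff)
qed

lemma submodule_preimage:
  assumes K: "submodule K R (quotient_module M W)"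
  shows "submodule {x \<in> carrier M. W +>\<^bsub>M\<^esub> x \<in> K} R M"
proof -
  have "W +>\<^bsub>M\<^esub> \<zero>\<^bsub>M\<^esub> \<in> K"
    using Q.submodule_zero[OF K] by (simp add: zero_quotient)
  moreover have "W +>\<^bsub>M\<^esub> (x \<oplus>\<^bsub>M\<^esub> y) \<in> K"
    if "x \<in> carrier M" "y \<in> carrier M" "W +>\<^bsub>M\<^esub> x \<in> K" "W +>\<^bsub>M\<^esub> y \<in> K" for x y
    using Q.submodule_add[OF K that(3,4)] that by (simp add: add_quotient)
  moreover have "W +>\<^bsub>M\<^esub> (r \<odot>\<^bsub>M\<^esub> x) \<in> K"
    if "r \<in> carrier R" "x \<in> carrier M" "W +>\<^bsub>M\<^esub> x \<in> K" for r x
    using Q.submodule_smult[OF K that(1,3)] that by (simp add: smult_quotient)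
  ultimately show ?thesis
    by (auto simp: submodule_iff)
qed

lemma subset_preimage:
  assumes K: "submodule K R (quotient_module M W)"
  shows "W \<subseteq> {x \<in> carrier M. W +>\<^bsub>M\<^esub> x \<in> K}"
proof
  fix x assume x: "x \<in> W"
  then have "W +>\<^bsub>M\<^esub> x = W +>\<^bsub>M\<^esub> \<zero>\<^bsub>M\<^esub>"
    by (subst coset_eq_iff) auto
  then show "x \<in> {x \<in> carrier M. W +>\<^bsub>M\<^esub> x \<in> K}"
    using x Q.submodule_zero[OF K] by (auto simp: zero_quotient)
qed

lemma image_preimage:
  assumes "submodule K R (quotient_module M W)"
  shows "(\<lambda>x. W +>\<^bsub>M\<^esub> x) ` {x \<in> carrier M. W +>\<^bsub>M\<^esub> x \<in> K} = K"
  using Q.submodule_subset[OF assms] by (auto simp: carrier_quotient)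

lemma preimage_image:
  assumes H: "submodule H R M" and "W \<subseteq> H"
  shows "{x \<in> carrier M. W +>\<^bsub>M\<^esub> x \<in> (\<lambda>x. W +>\<^bsub>M\<^esub> x) ` H} = H" (is "?P = H")
proof
  show "H \<subseteq> ?P" using submodule_subset[OF H] by auto
  show "?P \<subseteq> H"
  proof
    fix x assume "x \<in> ?P"
    then obtain h where x: "x \<in> carrier M" and h: "h \<in> H" and eq: "W +>\<^bsub>M\<^esub> x = W +>\<^bsub>M\<^esub> h"
      by auto
    have "x \<oplus>\<^bsub>M\<^esub> \<ominus>\<^bsub>M\<^esub> h \<in> H"
      using coset_eq_iff[of x h] x h eq submodule_subset[OF H] assms(2) by auto
    then show "x \<in> H"
      using submodule_add_cancel[OF H x] submodule_minus[OF H h] by blast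
  qed
qed

text \<open>
  Image and preimage under \<open>x \<mapsto> W + x\<close> are mutually inverse, inclusion-preserving bijections between
  the submodules of \<open>M\<close> that contain \<open>W\<close> and the submodules of the quotient.
\<close>

lemma maximal_quotient_iff:
  "(\<exists>K. maximal_submodule R (quotient_module M W) K) \<longleftrightarrow> (\<exists>N. maximal_submodule R M N \<and> W \<subseteq> N)"
proof
  assume "\<exists>K. maximal_submodule R (quotient_module M W) K"
  then obtain K where K: "submodule K R (quotient_module M W)" "K \<noteq> carrier (quotient_module M W)"
    and max: "\<And>L. submodule L R (quotient_module M W) \<Longrightarrow> K \<subseteq> L \<Longrightarrow>
       L = K \<or> L = carrier (quotient_module M W)"
    unfolding maximal_submodule_def by blast
  let ?N = "{x \<in> carrier M. W +>\<^bsub>M\<^esub> x \<in> K}"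
  have WN: "W \<subseteq> ?N" by (rule subset_preimage[OF K(1)])
  have "?N \<noteq> carrier M"
    using K image_preimage[OF K(1)] carrier_quotient by metis
  moreover have "L = ?N \<or> L = carrier M" if L: "submodule L R M" and NL: "?N \<subseteq> L" for L
  proof -
    have WL: "W \<subseteq> L" using WN NL by blast
    have "K \<subseteq> (\<lambda>x. W +>\<^bsub>M\<^esub> x) ` L"
      using image_mono[OF NL, of "\<lambda>x. W +>\<^bsub>M\<^esub> x"] unfolding image_preimage[OF K(1)] .
    then have "(\<lambda>x. W +>\<^bsub>M\<^esub> x) ` L = K \<or> (\<lambda>x. W +>\<^bsub>M\<^esub> x) ` L = carrier (quotient_module M W)"
      using max[OF submodule_image[OF L]] by blast
    then show ?thesis
      using preimage_image[OF L WL] by (auto simp: carrier_quotient)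
  qed
  ultimately show "\<exists>N. maximal_submodule R M N \<and> W \<subseteq> N"
    unfolding maximal_submodule_def using WN submodule_preimage[OF K(1)] by blast
next
  assume "\<exists>N. maximal_submodule R M N \<and> W \<subseteq> N"
  then obtain N where N: "submodule N R M" "N \<noteq> carrier M" and WN: "W \<subseteq> N"
    and max: "\<And>L. submodule L R M \<Longrightarrow> N \<subseteq> L \<Longrightarrow> L = N \<or> L = carrier M"
    unfolding maximal_submodule_def by blast
  let ?K = "(\<lambda>x. W +>\<^bsub>M\<^esub> x) ` N"
  have "?K \<noteq> carrier (quotient_module M W)"
    using preimage_image[OF N(1) WN] N(2) by (auto simp: carrier_quotient)
  moreover have "L = ?K \<or> L = carrier (quotient_module M W)"
    if L: "submodule L R (quotient_module M W)" and KL: "?K \<subseteq> L" for L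
  proof -
    have "N \<subseteq> {x \<in> carrier M. W +>\<^bsub>M\<^esub> x \<in> L}"
      using KL submodule_subset[OF N(1)] by blast
    then have "{x \<in> carrier M. W +>\<^bsub>M\<^esub> x \<in> L} = N \<or> {x \<in> carrier M. W +>\<^bsub>M\<^esub> x \<in> L} = carrier M"
      using max[OF submodule_preimage[OF L]] by blast
    then have "L = ?K \<or> L = (\<lambda>x. W +>\<^bsub>M\<^esub> x) ` carrier M"
      by (elim disjE) (use image_preimage[OF L] in \<open>simp only: simp_thms\<close>)+
    then show ?thesis
      unfolding carrier_quotient .
  qed
  ultimately show "\<exists>K. maximal_submodule R (quotient_module M W) K"
    unfolding maximal_submodule_def using submodule_image[OF N(1)] by blast
qed

end

lemma finitely_generated_iff:
  "finitely_generated R M \<longleftrightarrow>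
    (\<exists>S. finite S \<and> S \<subseteq> carrier M \<and> (\<forall>H. submodule H R M \<longrightarrow> S \<subseteq> H \<longrightarrow> H = carrier M))"
proof -
  have "(\<lambda>H. submodule H R M) hull S = carrier M \<longleftrightarrow>
      (\<forall>H. submodule H R M \<longrightarrow> S \<subseteq> H \<longrightarrow> H = carrier M)" if "S \<subseteq> carrier M" for S
    using that carrier_submodule submodule_subset unfolding hull_def by blast
  then show ?thesis unfolding finitely_generated_def by metis
qed

text \<open>
  The correspondence between submodules of \<open>M/N\<close> and submodules of \<open>M\<close> containing \<open>N\<close> also turns
  generators of the quotient into representatives in \<open>M\<close>: \<open>N\<close> is cofinite iff \<open>M\<close> is generated by
  \<open>N\<close> and a finite set.
\<close>

lemma cofinite_submodule_iff:
  "cofinite_submodule R M N \<longleftrightarrow> submodule N R M \<and>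
    (\<exists>S. finite S \<and> S \<subseteq> carrier M \<and>
      (\<forall>H. submodule H R M \<longrightarrow> N \<subseteq> H \<longrightarrow> S \<subseteq> H \<longrightarrow> H = carrier M))"
proof (cases "submodule N R M")
  case N: True
  interpret Q: left_module R "quotient_module M N" by (rule left_module_quotient[OF N])
  have "finitely_generated R (quotient_module M N) \<longleftrightarrow> (\<exists>S. finite S \<and> S \<subseteq> carrier M \<and>
      (\<forall>H. submodule H R M \<longrightarrow> N \<subseteq> H \<longrightarrow> S \<subseteq> H \<longrightarrow> H = carrier M))"
  proof
    assume "finitely_generated R (quotient_module M N)"
    then obtain T where T: "finite T" "T \<subseteq> (\<lambda>x. N +>\<^bsub>M\<^esub> x) ` carrier M"
      and gen: "\<And>H. submodule H R (quotient_module M N) \<Longrightarrow> T \<subseteq> H \<Longrightarrow>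
        H = (\<lambda>x. N +>\<^bsub>M\<^esub> x) ` carrier M"
      unfolding Q.finitely_generated_iff carrier_quotient[OF N] by blast
    obtain S where S: "S \<subseteq> carrier M" "finite S" "T = (\<lambda>x. N +>\<^bsub>M\<^esub> x) ` S"
      using finite_subset_image[OF T] by blast
    have "H = carrier M" if H: "submodule H R M" "N \<subseteq> H" "S \<subseteq> H" for H
    proof -
      have "(\<lambda>x. N +>\<^bsub>M\<^esub> x) ` H = (\<lambda>x. N +>\<^bsub>M\<^esub> x) ` carrier M"
        by (rule gen[OF submodule_image[OF N H(1)]]) (use H S in blast)
      then show ?thesis using preimage_image[OF N H(1,2)] by auto
    qed
    then show "\<exists>S. finite S \<and> S \<subseteq> carrier M \<and>
      (\<forall>H. submodule H R M \<longrightarrow> N \<subseteq> H \<longrightarrow> S \<subseteq> H \<longrightarrow> H = carrier M)"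
      using S by blast
  next
    assume "\<exists>S. finite S \<and> S \<subseteq> carrier M \<and>
      (\<forall>H. submodule H R M \<longrightarrow> N \<subseteq> H \<longrightarrow> S \<subseteq> H \<longrightarrow> H = carrier M)"
    then obtain S where S: "finite S" "S \<subseteq> carrier M"
      and gen: "\<And>H. submodule H R M \<Longrightarrow> N \<subseteq> H \<Longrightarrow> S \<subseteq> H \<Longrightarrow> H = carrier M" by blast
    have "K = (\<lambda>x. N +>\<^bsub>M\<^esub> x) ` carrier M"
      if K: "submodule K R (quotient_module M N)" and "(\<lambda>x. N +>\<^bsub>M\<^esub> x) ` S \<subseteq> K" for K
    proof -
      have "{x \<in> carrier M. N +>\<^bsub>M\<^esub> x \<in> K} = carrier M"
        by (rule gen[OF submodule_preimage[OF N K] subset_preimage[OF N K]]) (use that S in auto)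
      then show ?thesis using image_preimage[OF N K] by simp
    qed
    then show "finitely_generated R (quotient_module M N)"
      unfolding Q.finitely_generated_iff carrier_quotient[OF N]
      using S by (intro exI[of _ "(\<lambda>x. N +>\<^bsub>M\<^esub> x) ` S"]) blast
  qed
  then show ?thesis by (simp add: cofinite_submodule_def)
qed (simp add: cofinite_submodule_def)

end

section \<open>Maximal submodules and the radical\<close>

context left_module
begin

lemma maximal_submodule_cofinite:
  assumes N: "maximal_submodule R M N"
  shows "cofinite_submodule R M N"
proof -
  have sub: "submodule N R M" using N by (simp add: maximal_submodule_def)
  obtain x where x: "x \<in> carrier M" "x \<notin> N"
    using N submodule_subset[OF sub] by (auto simp: maximal_submodule_def)
  then have "H = carrier M" if "submodule H R M" "N \<subseteq> H" "{x} \<subseteq> H" for H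
    using N that unfolding maximal_submodule_def by blast
  then show ?thesis
    unfolding cofinite_submodule_iff using sub x
    by (intro conjI exI[of _ "{x}"]) auto
qed

lemma cofinite_submodule_mono:
  assumes "cofinite_submodule R M N" "N \<subseteq> L" "submodule L R M"
  shows "cofinite_submodule R M L"
  using assms unfolding cofinite_submodule_iff by (meson subset_trans)

text \<open>
  Zorn's lemma applies to the submodules that contain \<open>N\<close> but not the finite set \<open>S\<close> which generates
  \<open>M\<close> over \<open>N\<close>. These are the proper submodules containing \<open>N\<close>, and finiteness of \<open>S\<close> makes them
  closed under unions of nonempty chains.
\<close>

lemma maximal_submodule_exists:
  assumes N: "cofinite_submodule R M N" "N \<noteq> carrier M"
  obtains K where "maximal_submodule R M K" "N \<subseteq> K"
proof -
  from N(1) obtain S where sub: "submodule N R M" and S: "finite S" "S \<subseteq> carrier M"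
    and gen: "\<And>H. submodule H R M \<Longrightarrow> N \<subseteq> H \<Longrightarrow> S \<subseteq> H \<Longrightarrow> H = carrier M"
    unfolding cofinite_submodule_iff by blast
  let ?A = "{H. submodule H R M \<and> N \<subseteq> H \<and> \<not> S \<subseteq> H}"
  have "N \<in> ?A" using sub gen[OF sub] N(2) by blast
  then have nonempty: "?A \<noteq> {}" by blast
  have chain: "\<Union>C \<in> ?A" if ne: "C \<noteq> {}" and C: "subset.chain ?A C" for C
  proof -
    have CA: "C \<subseteq> ?A" and lin: "\<And>X Y. X \<in> C \<Longrightarrow> Y \<in> C \<Longrightarrow> X \<subseteq> Y \<or> Y \<subseteq> X"
      using C by (auto simp: subset_chain_def)
    have "x \<oplus>\<^bsub>M\<^esub> y \<in> \<Union>C" if xy: "x \<in> \<Union>C" "y \<in> \<Union>C" for x y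
    proof -
      obtain X where "X \<in> C" "x \<in> X" "y \<in> X" using xy lin by blast
      then show ?thesis using CA submodule_add by blast
    qed
    moreover have "\<zero>\<^bsub>M\<^esub> \<in> \<Union>C" "N \<subseteq> \<Union>C" using ne CA submodule_zero by blast+
    moreover have "\<Union>C \<subseteq> carrier M" using CA submodule_subset by blast
    moreover have "\<forall>a\<in>carrier R. \<forall>x\<in>\<Union>C. a \<odot>\<^bsub>M\<^esub> x \<in> \<Union>C" using CA submodule_smult by blast
    moreover have "\<not> S \<subseteq> \<Union>C"
      using finite_subset_Union_chain[OF S(1) _ ne C] CA by blast
    ultimately show ?thesis by (simp add: submodule_iff)
  qed
  obtain K where K: "K \<in> ?A" and max: "\<forall>X\<in>?A. K \<subseteq> X \<longrightarrow> X = K"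
    using subset_Zorn_nonempty[OF nonempty chain] ..
  have "L = K \<or> L = carrier M" if L: "submodule L R M" "K \<subseteq> L" for L
  proof (cases "S \<subseteq> L")
    case True
    then show ?thesis using gen[OF L(1)] L(2) K by blast
  next
    case False
    then show ?thesis using max L K by blast
  qed
  then have "maximal_submodule R M K"
    unfolding maximal_submodule_def using K S by blast
  then show thesis using that K by blast
qed

text \<open>
  The second isomorphism theorem identifies \<open>X/(K \<inter> X)\<close> with the simple module \<open>M/K\<close>. In terms of
  submodules: if \<open>K \<inter> X \<subseteq> L \<subseteq> X\<close>, then maximality of \<open>K\<close> leaves \<open>K + L = M\<close>, where the modular law
  gives \<open>L = X\<close>, or \<open>L \<subseteq> K\<close>.
\<close>

lemma maximal_submodule_Int:
  assumes K: "maximal_submodule R M K" and X: "submodule X R M" "\<not> X \<subseteq> K"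
  shows "maximal_submodule R (M\<lparr>carrier := X\<rparr>) (K \<inter> X)"
proof -
  have sub: "submodule K R M" and max: "\<And>L. submodule L R M \<Longrightarrow> K \<subseteq> L \<Longrightarrow> L = K \<or> L = carrier M"
    using K by (auto simp: maximal_submodule_def)
  have "L = K \<inter> X \<or> L = X" if L: "submodule L R M" "L \<subseteq> X" "K \<inter> X \<subseteq> L" for L
  proof (rule disjCI)
    assume ne: "L \<noteq> X"
    have "K <+>\<^bsub>M\<^esub> L \<noteq> carrier M"
    proof
      assume eq: "K <+>\<^bsub>M\<^esub> L = carrier M"
      have "x \<in> L" if x: "x \<in> X" for x
      proof -
        obtain k l where kl: "k \<in> K" "l \<in> L" "x = k \<oplus>\<^bsub>M\<^esub> l"
          using x eq submodule_subset[OF X(1)] mem_set_add by blast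
        then have "k \<in> X"
          using submodule_add_cancel[OF X(1), of k l] x L(2) submodule_subset[OF sub] by blast
        then show ?thesis using kl L submodule_add[OF L(1)] by blast
      qed
      then show False using ne L by blast
    qed
    then have "L \<subseteq> K"
      using max[OF submodule_set_add[OF sub L(1)] set_add_upper1[OF sub L(1)]]
        set_add_upper2[OF sub L(1)] by simp
    then show "L = K \<inter> X" using L by blast
  qed
  then show ?thesis
    unfolding maximal_submodule_def submodule_restrict_iff[OF X(1)]
    using submodule_Int[OF sub X(1)] X by auto
qed

text \<open>
  The two cases in the definition of the radical become one by treating an empty intersection of
  submodules of \<open>M\<close> as \<open>M\<close>.
\<close>

lemma mem_Rad_iff: "x \<in> Rad R M \<longleftrightarrow> x \<in> carrier M \<and> (\<forall>K. maximal_submodule R M K \<longrightarrow> x \<in> K)"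
proof -
  have "K \<subseteq> carrier M" if "maximal_submodule R M K" for K
    using that submodule_subset by (simp add: maximal_submodule_def)
  then show ?thesis unfolding Rad_def by auto
qed

text \<open>
  A maximal submodule \<open>K\<close> of \<open>M\<close> either contains \<open>X\<close> or meets it in a maximal submodule of \<open>X\<close>. In
  both cases \<open>Rad(X) \<subseteq> K\<close>.
\<close>

lemma Rad_restrict_subset:
  assumes X: "submodule X R M"
  shows "Rad R (M\<lparr>carrier := X\<rparr>) \<subseteq> Rad R M"
proof
  interpret X: left_module R "M\<lparr>carrier := X\<rparr>" by (rule left_module_submodule[OF X])
  fix x assume x: "x \<in> Rad R (M\<lparr>carrier := X\<rparr>)"
  have "x \<in> K" if "maximal_submodule R M K" for K
    using maximal_submodule_Int[OF that X] x by (cases "X \<subseteq> K") (auto simp: X.mem_Rad_iff)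
  then show "x \<in> Rad R M"
    using x submodule_subset[OF X] by (auto simp: mem_Rad_iff X.mem_Rad_iff)
qed

lemma Rad_mono:
  assumes "submodule X R M" "submodule Z R M" "X \<subseteq> Z"
  shows "Rad R (M\<lparr>carrier := X\<rparr>) \<subseteq> Rad R (M\<lparr>carrier := Z\<rparr>)"
  using left_module.Rad_restrict_subset[OF left_module_submodule[OF assms(2)], of X]
  by (simp add: submodule_restrict_iff assms)

lemma Rad_add:
  "x \<in> Rad R M \<Longrightarrow> y \<in> Rad R M \<Longrightarrow> x \<oplus>\<^bsub>M\<^esub> y \<in> Rad R M"
  by (auto simp: mem_Rad_iff maximal_submodule_def submodule_add)

lemma zero_mem_Rad: "\<zero>\<^bsub>M\<^esub> \<in> Rad R M"
  by (auto simp: mem_Rad_iff maximal_submodule_def submodule_zero)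

section \<open>Rad-supplements\<close>

lemma Rad_supplement_carrier: "Rad_supplement R M (carrier M) {\<zero>\<^bsub>M\<^esub>}"
proof -
  interpret Z: left_module R "M\<lparr>carrier := {\<zero>\<^bsub>M\<^esub>}\<rparr>"
    by (rule left_module_submodule[OF zero_submodule])
  have "carrier M <+>\<^bsub>M\<^esub> {\<zero>\<^bsub>M\<^esub>} = carrier M"
    by (auto simp: mem_set_add)
  then show ?thesis
    using Z.zero_mem_Rad by (auto simp: Rad_supplement_def zero_submodule)
qed

text \<open>
  In a w-local module every proper cofinite submodule lies in the unique maximal submodule, that is,
  in the radical, so the whole module is a Rad-supplement of it.
\<close>

lemma w_local_imp_cofinitely_Rad_supplemented:
  assumes "w_local R M"
  shows "cofinitely_Rad_supplemented R M"
  unfolding cofinitely_Rad_supplemented_def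
proof (intro allI impI)
  fix N assume N: "cofinite_submodule R M N"
  then have sub: "submodule N R M" by (simp add: cofinite_submodule_def)
  show "\<exists>L. Rad_supplement R M N L"
  proof (cases "N = carrier M")
    case True
    then show ?thesis using Rad_supplement_carrier by blast
  next
    case False
    then obtain K where K: "maximal_submodule R M K" "N \<subseteq> K"
      using maximal_submodule_exists[OF N] by blast
    then have "N \<subseteq> K'" if "maximal_submodule R M K'" for K'
      using assms that unfolding w_local_def by blast
    then have "N \<subseteq> Rad R M"
      using submodule_subset[OF sub] unfolding subset_iff mem_Rad_iff by blast
    moreover have "N <+>\<^bsub>M\<^esub> carrier M = carrier M"
      using submodule_set_add[OF sub carrier_submodule, THEN submodule_subset]
        set_add_upper2[OF sub carrier_submodule] by blast
    ultimately have "Rad_supplement R M N (carrier M)"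
      by (auto simp: Rad_supplement_def carrier_submodule)
    then show ?thesis by blast
  qed
qed

text \<open>
  \<open>N \<inter> L\<close> is a maximal submodule of \<open>L\<close> contained in \<open>Rad(L)\<close>, hence in every maximal submodule of
  \<open>L\<close>, hence equal to each of them.
\<close>

lemma Rad_supplement_of_maximal_w_local:
  assumes N: "maximal_submodule R M N" and L: "Rad_supplement R M N L"
  shows "submodule L R M \<and> w_local R (M\<lparr>carrier := L\<rparr>) \<and> \<not> L \<subseteq> N"
proof -
  have subL: "submodule L R M" and sum: "N <+>\<^bsub>M\<^esub> L = carrier M"
    and rad: "N \<inter> L \<subseteq> Rad R (M\<lparr>carrier := L\<rparr>)"
    using L by (auto simp: Rad_supplement_def)
  have subN: "submodule N R M" "N \<noteq> carrier M" using N by (auto simp: maximal_submodule_def)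
  interpret L: left_module R "M\<lparr>carrier := L\<rparr>" by (rule left_module_submodule[OF subL])
  have nle: "\<not> L \<subseteq> N"
  proof
    assume "L \<subseteq> N"
    then have "N <+>\<^bsub>M\<^esub> L \<subseteq> N" using submodule_add[OF subN(1)] unfolding subset_iff mem_set_add by blast
    then show False using sum subN submodule_subset by blast
  qed
  have max: "maximal_submodule R (M\<lparr>carrier := L\<rparr>) (N \<inter> L)"
    by (rule maximal_submodule_Int[OF N subL nle])
  have "K = N \<inter> L" if K: "maximal_submodule R (M\<lparr>carrier := L\<rparr>) K" for K
  proof -
    have "N \<inter> L \<subseteq> K" using rad K by (auto simp: L.mem_Rad_iff)
    then show ?thesis using K max unfolding maximal_submodule_def by blast
  qed
  then show ?thesis using subL max nle unfolding w_local_def by blast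
qed

text \<open>
  If \<open>P + U = M\<close>, then \<open>U/(U \<inter> P)\<close> is isomorphic to the finitely generated module \<open>M/P\<close>. Generators
  are found by choosing, for each \<open>s\<close> in a finite set generating \<open>M\<close> over \<open>P\<close>, an element
  \<open>u\<close> of \<open>U\<close> with \<open>s \<in> P + u\<close>.
\<close>

lemma cofinite_submodule_restrict:
  assumes P: "cofinite_submodule R M P" and U: "submodule U R M"
    and sum: "P <+>\<^bsub>M\<^esub> U = carrier M"
  shows "cofinite_submodule R (M\<lparr>carrier := U\<rparr>) (U \<inter> P)"
proof -
  interpret U: left_module R "M\<lparr>carrier := U\<rparr>" by (rule left_module_submodule[OF U])
  have subP: "submodule P R M" using P by (simp add: cofinite_submodule_def)
  obtain S where S: "finite S" "S \<subseteq> carrier M"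
    and gen: "\<And>H. submodule H R M \<Longrightarrow> P \<subseteq> H \<Longrightarrow> S \<subseteq> H \<Longrightarrow> H = carrier M"
    using P unfolding cofinite_submodule_iff by blast
  have "\<forall>s\<in>S. \<exists>u. u \<in> U \<and> (\<exists>p\<in>P. s = p \<oplus>\<^bsub>M\<^esub> u)"
    using S(2) sum mem_set_add by blast
  then obtain u where u: "\<And>s. s \<in> S \<Longrightarrow> u s \<in> U \<and> (\<exists>p\<in>P. s = p \<oplus>\<^bsub>M\<^esub> u s)"
    by metis
  have "H = U" if H: "submodule H R M" "H \<subseteq> U" "U \<inter> P \<subseteq> H" "u ` S \<subseteq> H" for H
  proof -
    have eq: "P <+>\<^bsub>M\<^esub> H = carrier M"
    proof (rule gen[OF submodule_set_add[OF subP H(1)] set_add_upper1[OF subP H(1)]])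
      show "S \<subseteq> P <+>\<^bsub>M\<^esub> H" using u H(4) unfolding subset_iff mem_set_add by blast
    qed
    have "z \<in> H" if z: "z \<in> U" for z
    proof -
      obtain p h where ph: "p \<in> P" "h \<in> H" "z = p \<oplus>\<^bsub>M\<^esub> h"
        using z eq submodule_subset[OF U] mem_set_add by blast
      then have "p \<in> U"
        using submodule_add_cancel[OF U, of p h] z H(2) submodule_subset[OF subP] by blast
      then show ?thesis using ph H submodule_add[OF H(1)] by blast
    qed
    then show ?thesis using H by blast
  qed
  then have "\<exists>T. finite T \<and> T \<subseteq> U \<and>
     (\<forall>H. submodule H R M \<and> H \<subseteq> U \<longrightarrow> U \<inter> P \<subseteq> H \<longrightarrow> T \<subseteq> H \<longrightarrow> H = U)"
    using u S by (intro exI[of _ "u ` S"]) auto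
  then show ?thesis
    unfolding U.cofinite_submodule_iff submodule_restrict_iff[OF U]
    using submodule_Int[OF U subP] by simp
qed

text \<open>
  Let \<open>X\<close> be a Rad-supplement of \<open>N + U\<close>. Then \<open>(N + X) + U = M\<close>, so \<open>U \<inter> (N + X)\<close> is cofinite in \<open>U\<close>
  and has a Rad-supplement \<open>Y\<close> in \<open>U\<close>. The sum \<open>X + Y\<close> is a Rad-supplement of \<open>N\<close>. Indeed
  \<open>N + X + Y\<close> contains \<open>N + X\<close> and \<open>U = U \<inter> (N + X) + Y\<close>, so it is \<open>M\<close>, and if
  \<open>n = x + y\<close> with \<open>n \<in> N\<close>, \<open>x \<in> X\<close> and \<open>y \<in> Y\<close>, then \<open>x = n - y\<close> lies in \<open>(N + U) \<inter> X \<subseteq> Rad(X)\<close> and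
  \<open>y = n - x\<close> lies in \<open>(N + X) \<inter> Y \<subseteq> Rad(Y)\<close>, and both radicals are contained in \<open>Rad(X + Y)\<close>.
\<close>

lemma Rad_supplement_step:
  assumes N: "cofinite_submodule R M N" and U: "submodule U R M"
    and crs: "cofinitely_Rad_supplemented R (M\<lparr>carrier := U\<rparr>)"
    and X: "Rad_supplement R M (N <+>\<^bsub>M\<^esub> U) X"
  shows "\<exists>L. Rad_supplement R M N L"
proof -
  have subN: "submodule N R M" using N by (simp add: cofinite_submodule_def)
  have subX: "submodule X R M" and sumX: "(N <+>\<^bsub>M\<^esub> U) <+>\<^bsub>M\<^esub> X = carrier M"
    and radX: "(N <+>\<^bsub>M\<^esub> U) \<inter> X \<subseteq> Rad R (M\<lparr>carrier := X\<rparr>)"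
    using X by (auto simp: Rad_supplement_def)
  let ?P = "N <+>\<^bsub>M\<^esub> X"
  have subP: "submodule ?P R M" by (rule submodule_set_add[OF subN subX])
  note sub = submodule_subset[OF subN, THEN subsetD] submodule_subset[OF U, THEN subsetD]
    submodule_subset[OF subX, THEN subsetD]
  have "carrier M \<subseteq> ?P <+>\<^bsub>M\<^esub> U"
  proof
    fix z assume "z \<in> carrier M"
    then have "z \<in> (N <+>\<^bsub>M\<^esub> U) <+>\<^bsub>M\<^esub> X" by (simp only: sumX)
    then obtain m x where m: "m \<in> N <+>\<^bsub>M\<^esub> U" and x: "x \<in> X" "z = m \<oplus>\<^bsub>M\<^esub> x"
      by (meson mem_set_add)
    then obtain n u where "n \<in> N" "u \<in> U" "m = n \<oplus>\<^bsub>M\<^esub> u"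
      by (meson mem_set_add)
    then have z: "n \<in> N" "u \<in> U" "x \<in> X" "z = (n \<oplus>\<^bsub>M\<^esub> u) \<oplus>\<^bsub>M\<^esub> x"
      using x by simp_all
    then have "z = (n \<oplus>\<^bsub>M\<^esub> x) \<oplus>\<^bsub>M\<^esub> u" using sub by (simp add: M.a_ac)
    moreover have "n \<oplus>\<^bsub>M\<^esub> x \<in> ?P" using z by (auto simp: mem_set_add)
    ultimately show "z \<in> ?P <+>\<^bsub>M\<^esub> U" using z(2) by (subst mem_set_add) blast
  qed
  then have sumP: "?P <+>\<^bsub>M\<^esub> U = carrier M"
    using submodule_subset[OF submodule_set_add[OF subP U]] by blast
  have "cofinite_submodule R (M\<lparr>carrier := U\<rparr>) (U \<inter> ?P)"
    by (rule cofinite_submodule_restrict[OF cofinite_submodule_mono[OF N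
          set_add_upper1[OF subN subX] subP] U sumP])
  then obtain Y where Y: "Rad_supplement R (M\<lparr>carrier := U\<rparr>) (U \<inter> ?P) Y"
    using crs unfolding cofinitely_Rad_supplemented_def by blast
  then have subY: "submodule Y R M" "Y \<subseteq> U" and sumY: "(U \<inter> ?P) <+>\<^bsub>M\<^esub> Y = U"
    and radY: "?P \<inter> Y \<subseteq> Rad R (M\<lparr>carrier := Y\<rparr>)"
    by (auto simp: Rad_supplement_def submodule_restrict_iff[OF U])
  let ?L = "X <+>\<^bsub>M\<^esub> Y"
  have subL: "submodule ?L R M" by (rule submodule_set_add[OF subX subY(1)])
  have subNL: "submodule (N <+>\<^bsub>M\<^esub> ?L) R M" by (rule submodule_set_add[OF subN subL])
  note up = set_add_upper1[OF subN subL] set_add_upper2[OF subN subL]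
    set_add_upper1[OF subX subY(1)] set_add_upper2[OF subX subY(1)]
  interpret L: left_module R "M\<lparr>carrier := ?L\<rparr>" by (rule left_module_submodule[OF subL])
  have P_le: "?P \<subseteq> N <+>\<^bsub>M\<^esub> ?L"
    using up submodule_add[OF subNL] unfolding subset_iff mem_set_add[of _ N X] by metis
  then have U_le: "U \<subseteq> N <+>\<^bsub>M\<^esub> ?L"
  proof -
    have "u \<in> N <+>\<^bsub>M\<^esub> ?L" if u: "u \<in> U" for u
    proof -
      obtain p y where "p \<in> ?P" "y \<in> Y" "u = p \<oplus>\<^bsub>M\<^esub> y"
        using u sumY unfolding set_eq_iff mem_set_add[of _ _ Y] by blast
      then show ?thesis using P_le up submodule_add[OF subNL] by blast
    qed
    then show ?thesis by blast
  qed
  have sumL: "N <+>\<^bsub>M\<^esub> ?L = carrier M"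
  proof
    show "carrier M \<subseteq> N <+>\<^bsub>M\<^esub> ?L"
    proof
      fix z assume "z \<in> carrier M"
      then obtain p u where "p \<in> ?P" "u \<in> U" "z = p \<oplus>\<^bsub>M\<^esub> u"
        unfolding sumP[symmetric] mem_set_add[of _ _ U] by blast
      then show "z \<in> N <+>\<^bsub>M\<^esub> ?L"
        using submodule_add[OF subNL] P_le[THEN subsetD] U_le[THEN subsetD] by blast
    qed
  qed (rule submodule_subset[OF subNL])
  have "N \<inter> ?L \<subseteq> Rad R (M\<lparr>carrier := ?L\<rparr>)"
  proof
    fix n assume "n \<in> N \<inter> ?L"
    then obtain x y where n: "n \<in> N" and xy: "x \<in> X" "y \<in> Y" "n = x \<oplus>\<^bsub>M\<^esub> y"
      unfolding mem_set_add[of _ X Y] Int_iff by blast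
    have yU: "y \<in> U" using xy subY by blast
    have subNU: "submodule (N <+>\<^bsub>M\<^esub> U) R M" by (rule submodule_set_add[OF subN U])
    have "x \<in> N <+>\<^bsub>M\<^esub> U"
      by (rule submodule_add_cancel[OF subNU, of x y])
        (use xy n yU sub set_add_upper1[OF subN U] set_add_upper2[OF subN U] in auto)
    then have x: "x \<in> Rad R (M\<lparr>carrier := ?L\<rparr>)"
      using xy radX Rad_mono[OF subX subL up(3)] by blast
    have "y \<in> ?P"
      by (rule submodule_add_cancel'[OF subP, of y x])
        (use xy n yU sub set_add_upper1[OF subN subX] set_add_upper2[OF subN subX] in auto)
    then have "y \<in> Rad R (M\<lparr>carrier := ?L\<rparr>)"
      using xy radY Rad_mono[OF subY(1) subL up(4)] by blast
    then show "n \<in> Rad R (M\<lparr>carrier := ?L\<rparr>)"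
      using L.Rad_add[OF x] xy(3) by simp
  qed
  then show ?thesis
    using subL sumL unfolding Rad_supplement_def by blast
qed

text \<open>
  Induction on the finite family, with \<open>N\<close> varying: the induction hypothesis is applied to the larger
  cofinite submodule \<open>N + U\<close>, for which one member fewer suffices.
\<close>

lemma Rad_supplement_if_generated:
  assumes "finite \<G>"
    and "\<And>U. U \<in> \<G> \<Longrightarrow> submodule U R M \<and> cofinitely_Rad_supplemented R (M\<lparr>carrier := U\<rparr>)"
    and "cofinite_submodule R M N"
    and "\<And>H. submodule H R M \<Longrightarrow> N \<subseteq> H \<Longrightarrow> \<Union>\<G> \<subseteq> H \<Longrightarrow> H = carrier M"
  shows "\<exists>L. Rad_supplement R M N L"
  using assms
proof (induction arbitrary: N rule: finite_induct)
  case empty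
  then have "N = carrier M" by (auto simp: cofinite_submodule_def)
  then show ?case using Rad_supplement_carrier by blast
next
  case (insert U \<G>)
  have U: "submodule U R M" "cofinitely_Rad_supplemented R (M\<lparr>carrier := U\<rparr>)"
    using insert.prems(1) by auto
  have N: "submodule N R M" using insert.prems(2) by (simp add: cofinite_submodule_def)
  have "cofinite_submodule R M (N <+>\<^bsub>M\<^esub> U)"
    by (rule cofinite_submodule_mono[OF insert.prems(2) set_add_upper1[OF N U(1)]
          submodule_set_add[OF N U(1)]])
  moreover have "H = carrier M" if "submodule H R M" "N <+>\<^bsub>M\<^esub> U \<subseteq> H" "\<Union>\<G> \<subseteq> H" for H
    using insert.prems(3)[OF that(1)] that set_add_upper1[OF N U(1)] set_add_upper2[OF N U(1)]
    by auto
  ultimately have "\<exists>X. Rad_supplement R M (N <+>\<^bsub>M\<^esub> U) X"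
    using insert.IH insert.prems(1) by auto
  then show ?case using Rad_supplement_step[OF insert.prems(2) U] by blast
qed

section \<open>Sums of families of submodules\<close>

lemma finsum_mem_submodule:
  assumes H: "submodule H R M" and "finite \<G>" "\<And>L. L \<in> \<G> \<Longrightarrow> f L \<in> H"
  shows "finsum M f \<G> \<in> H"
  using assms(2,3)
proof (induction rule: finite_induct)
  case empty
  then show ?case using submodule_zero[OF H] by simp
next
  case (insert L \<G>)
  have "f \<in> insert L \<G> \<rightarrow> carrier M" using insert.prems submodule_subset[OF H] by auto
  then show ?case using insert submodule_add[OF H] by simp
qed

lemma submodule_sum_least:
  assumes "submodule H R M" "\<And>L. L \<in> \<F> \<Longrightarrow> L \<subseteq> H"
  shows "submodule_sum M \<F> \<subseteq> H"
proof
  fix x assume "x \<in> submodule_sum M \<F>"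
  then obtain f \<G> where f: "finite \<G>" "\<G> \<subseteq> \<F>" "\<forall>L\<in>\<G>. f L \<in> L" and x: "x = finsum M f \<G>"
    unfolding submodule_sum_def by blast
  then have "f L \<in> H" if "L \<in> \<G>" for L
    using that assms(2)[of L] by blast
  then show "x \<in> H"
    unfolding x using finsum_mem_submodule[OF assms(1) f(1)] by blast
qed

lemma submodule_sum_upper:
  assumes "\<And>L. L \<in> \<F> \<Longrightarrow> submodule L R M" "L \<in> \<F>"
  shows "L \<subseteq> submodule_sum M \<F>"
proof
  fix x assume x: "x \<in> L"
  then have "x = finsum M (\<lambda>_. x) {L}"
    using submodule_subset[OF assms(1)[OF assms(2)]] by auto
  then show "x \<in> submodule_sum M \<F>"
    unfolding submodule_sum_def using x assms(2) by blast
qed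

lemma submodule_submodule_sum:
  assumes \<F>: "\<And>L. L \<in> \<F> \<Longrightarrow> submodule L R M"
  shows "submodule (submodule_sum M \<F>) R M"
proof -
  have add: "finsum M f \<G> \<oplus>\<^bsub>M\<^esub> finsum M g \<H> \<in> submodule_sum M \<F>"
    if f: "finite \<G>" "\<G> \<subseteq> \<F>" "\<forall>L\<in>\<G>. f L \<in> L" and g: "finite \<H>" "\<H> \<subseteq> \<F>" "\<forall>L\<in>\<H>. g L \<in> L"
    for f g \<G> \<H>
  proof -
    \<comment> \<open>Extending both functions by zero makes both sums range over the same finite subfamily.\<close>
    define f' where "f' = (\<lambda>L. if L \<in> \<G> then f L else \<zero>\<^bsub>M\<^esub>)"
    define g' where "g' = (\<lambda>L. if L \<in> \<H> then g L else \<zero>\<^bsub>M\<^esub>)"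
    have mem: "f' L \<in> L \<and> g' L \<in> L \<and> L \<subseteq> carrier M" if "L \<in> \<G> \<union> \<H>" for L
    proof -
      have L: "submodule L R M" using that f(2) g(2) \<F> by blast
      then show ?thesis
        using f(3) g(3) submodule_zero[OF L] submodule_subset[OF L] unfolding f'_def g'_def by simp
    qed
    have car: "f' \<in> \<G> \<union> \<H> \<rightarrow> carrier M" "g' \<in> \<G> \<union> \<H> \<rightarrow> carrier M" using mem by blast+
    have "finsum M f \<G> = finsum M f' (\<G> \<union> \<H>)"
      using car(1) f g by (intro M.add.finprod_mono_neutral_cong_left) (auto simp: f'_def)
    moreover have "finsum M g \<H> = finsum M g' (\<G> \<union> \<H>)"
      using car(2) f g by (intro M.add.finprod_mono_neutral_cong_left) (auto simp: g'_def)
    ultimately have "finsum M f \<G> \<oplus>\<^bsub>M\<^esub> finsum M g \<H> = finsum M (\<lambda>L. f' L \<oplus>\<^bsub>M\<^esub> g' L) (\<G> \<union> \<H>)"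
      using car by (simp add: M.finsum_addf)
    moreover have "\<forall>L\<in>\<G> \<union> \<H>. f' L \<oplus>\<^bsub>M\<^esub> g' L \<in> L"
      using mem f(2) g(2) \<F> submodule_add by blast
    moreover have "finite (\<G> \<union> \<H>)" "\<G> \<union> \<H> \<subseteq> \<F>" using f g by auto
    ultimately show ?thesis unfolding submodule_sum_def by blast
  qed
  have smult: "a \<odot>\<^bsub>M\<^esub> finsum M f \<G> = finsum M (\<lambda>L. a \<odot>\<^bsub>M\<^esub> f L) \<G>"
    if "a \<in> carrier R" "finite \<G>" "f \<in> \<G> \<rightarrow> carrier M" for a f \<G>
    using that(2,3)
  proof (induction rule: finite_induct)
    case (insert L \<G>)
    have "(\<lambda>L. a \<odot>\<^bsub>M\<^esub> f L) \<in> \<G> \<rightarrow> carrier M" using insert.prems that(1) by auto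
    then show ?case using insert that(1) by (auto simp: smult_r_distr)
  qed (simp add: that(1))
  have "a \<odot>\<^bsub>M\<^esub> x \<in> submodule_sum M \<F>" if a: "a \<in> carrier R" and x: "x \<in> submodule_sum M \<F>" for a x
  proof -
    obtain f \<G> where f: "finite \<G>" "\<G> \<subseteq> \<F>" "\<forall>L\<in>\<G>. f L \<in> L" "x = finsum M f \<G>"
      using x unfolding submodule_sum_def by blast
    have "f \<in> \<G> \<rightarrow> carrier M" using f \<F> submodule_subset by blast
    then have "a \<odot>\<^bsub>M\<^esub> x = finsum M (\<lambda>L. a \<odot>\<^bsub>M\<^esub> f L) \<G>" using smult a f by simp
    moreover have "\<forall>L\<in>\<G>. a \<odot>\<^bsub>M\<^esub> f L \<in> L" using f \<F> a submodule_smult by blast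
    ultimately show ?thesis using f(1,2) unfolding submodule_sum_def by blast
  qed
  moreover have "\<zero>\<^bsub>M\<^esub> \<in> submodule_sum M \<F>"
  proof -
    have "finsum M (\<lambda>_. \<zero>\<^bsub>M\<^esub>) {} \<in> submodule_sum M \<F>"
      unfolding submodule_sum_def
      by (intro CollectI exI[of _ "\<lambda>_. \<zero>\<^bsub>M\<^esub>"] exI[of _ "{}"]) simp
    then show ?thesis by simp
  qed
  moreover have "submodule_sum M \<F> \<subseteq> carrier M"
    using submodule_sum_least[OF carrier_submodule] \<F> submodule_subset by blast
  moreover have "x \<oplus>\<^bsub>M\<^esub> y \<in> submodule_sum M \<F>"
    if x: "x \<in> submodule_sum M \<F>" and y: "y \<in> submodule_sum M \<F>" for x y
  proof -
    obtain f \<G> where f: "finite \<G>" "\<G> \<subseteq> \<F>" "\<forall>L\<in>\<G>. f L \<in> L" "x = finsum M f \<G>"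
      using x unfolding submodule_sum_def by blast
    obtain g \<H> where g: "finite \<H>" "\<H> \<subseteq> \<F>" "\<forall>L\<in>\<H>. g L \<in> L" "y = finsum M g \<H>"
      using y unfolding submodule_sum_def by blast
    show ?thesis unfolding f(4) g(4) by (rule add[OF f(1-3) g(1-3)])
  qed
  ultimately show ?thesis by (simp add: submodule_iff)
qed

text \<open>
  Each of the finitely many generators of \<open>M\<close> over \<open>N\<close> lies in the sum of \<open>N\<close> and finitely many
  members of the family.
\<close>

lemma finite_subfamily_generates:
  assumes N: "cofinite_submodule R M N" and sum: "N <+>\<^bsub>M\<^esub> submodule_sum M \<F> = carrier M"
  obtains \<G> where "finite \<G>" "\<G> \<subseteq> \<F>"
    "\<And>H. submodule H R M \<Longrightarrow> N \<subseteq> H \<Longrightarrow> \<Union>\<G> \<subseteq> H \<Longrightarrow> H = carrier M"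
proof -
  obtain S where S: "finite S" "S \<subseteq> carrier M"
    and gen: "\<And>H. submodule H R M \<Longrightarrow> N \<subseteq> H \<Longrightarrow> S \<subseteq> H \<Longrightarrow> H = carrier M"
    using N unfolding cofinite_submodule_iff by blast
  have "\<exists>\<G>. finite \<G> \<and> \<G> \<subseteq> \<F> \<and> (\<forall>H. submodule H R M \<longrightarrow> N \<subseteq> H \<longrightarrow> \<Union>\<G> \<subseteq> H \<longrightarrow> s \<in> H)"
    if s: "s \<in> S" for s
  proof -
    have "s \<in> N <+>\<^bsub>M\<^esub> submodule_sum M \<F>" using s S(2) sum by blast
    then obtain n y where n: "n \<in> N" and y: "y \<in> submodule_sum M \<F>" and ny: "s = n \<oplus>\<^bsub>M\<^esub> y"
      unfolding mem_set_add by blast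
    from y obtain f \<G> where \<G>: "finite \<G>" "\<G> \<subseteq> \<F>" and f: "\<forall>L\<in>\<G>. f L \<in> L" "y = finsum M f \<G>"
      unfolding submodule_sum_def by blast
    have "s \<in> H" if H: "submodule H R M" "N \<subseteq> H" "\<Union>\<G> \<subseteq> H" for H
    proof -
      have "f L \<in> H" if "L \<in> \<G>" for L using that f(1) H(3) by blast
      then have "y \<in> H"
        unfolding f(2) using finsum_mem_submodule[OF H(1) \<G>(1)] by blast
      then show ?thesis unfolding ny using n H(2) submodule_add[OF H(1)] by blast
    qed
    then show ?thesis using \<G> by blast
  qed
  then obtain \<G> where \<G>: "\<And>s. s \<in> S \<Longrightarrow> finite (\<G> s) \<and> \<G> s \<subseteq> \<F> \<and>
      (\<forall>H. submodule H R M \<longrightarrow> N \<subseteq> H \<longrightarrow> \<Union>(\<G> s) \<subseteq> H \<longrightarrow> s \<in> H)" by metis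
  show thesis
  proof (rule that[of "\<Union>(\<G> ` S)"])
    fix H assume H: "submodule H R M" "N \<subseteq> H" "\<Union>(\<Union>(\<G> ` S)) \<subseteq> H"
    have "s \<in> H" if s: "s \<in> S" for s
    proof -
      have "\<Union>(\<G> s) \<subseteq> H" using H(3) s by blast
      then show ?thesis using \<G>[OF s] H by blast
    qed
    then show "H = carrier M" using gen H by blast
  qed (use S \<G> in auto)
qed

section \<open>The equivalences\<close>

lemma wLoc_submodule: "submodule (wLoc R M) R M"
  unfolding wLoc_def by (rule submodule_submodule_sum) blast

lemma cgs_submodule: "submodule (cgs R M) R M"
  unfolding cgs_def by (rule submodule_submodule_sum) blast

lemma wLoc_subset_cgs: "wLoc R M \<subseteq> cgs R M"
  unfolding wLoc_def
proof (rule submodule_sum_least[OF cgs_submodule])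
  fix L assume "L \<in> {L. submodule L R M \<and> w_local R (M\<lparr>carrier := L\<rparr>)}"
  then have "L \<in> {L. submodule L R M \<and> cofinitely_Rad_supplemented R (M\<lparr>carrier := L\<rparr>)}"
    using left_module.w_local_imp_cofinitely_Rad_supplemented[OF left_module_submodule] by blast
  then show "L \<subseteq> cgs R M"
    unfolding cgs_def by (rule submodule_sum_upper[rotated]) blast
qed

lemma Rad_supplement_imp_wLoc_not_subset:
  assumes "maximal_submodule R M N" "Rad_supplement R M N L"
  shows "\<not> wLoc R M \<subseteq> N"
proof -
  have L: "submodule L R M \<and> w_local R (M\<lparr>carrier := L\<rparr>)" "\<not> L \<subseteq> N"
    using Rad_supplement_of_maximal_w_local[OF assms] by auto
  then have "L \<subseteq> wLoc R M"
    unfolding wLoc_def by (intro submodule_sum_upper) auto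
  then show ?thesis using L by blast
qed

lemma cofinitely_Rad_supplemented_if_no_maximal_over_cgs:
  assumes no: "\<And>K. maximal_submodule R M K \<Longrightarrow> \<not> cgs R M \<subseteq> K"
  shows "cofinitely_Rad_supplemented R M"
  unfolding cofinitely_Rad_supplemented_def
proof (intro allI impI)
  fix N assume N: "cofinite_submodule R M N"
  then have sub: "submodule N R M" by (simp add: cofinite_submodule_def)
  have subs: "submodule (N <+>\<^bsub>M\<^esub> cgs R M) R M"
    by (rule submodule_set_add[OF sub cgs_submodule])
  have "N <+>\<^bsub>M\<^esub> cgs R M = carrier M"
  proof (rule ccontr)
    assume "N <+>\<^bsub>M\<^esub> cgs R M \<noteq> carrier M"
    then obtain K where "maximal_submodule R M K" "N <+>\<^bsub>M\<^esub> cgs R M \<subseteq> K"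
      using maximal_submodule_exists[OF cofinite_submodule_mono[OF N
            set_add_upper1[OF sub cgs_submodule] subs]] by blast
    then show False using no set_add_upper2[OF sub cgs_submodule] by blast
  qed
  then obtain \<G> where fin: "finite \<G>"
    and crs: "\<G> \<subseteq> {L. submodule L R M \<and> cofinitely_Rad_supplemented R (M\<lparr>carrier := L\<rparr>)}"
    and gen: "\<And>H. submodule H R M \<Longrightarrow> N \<subseteq> H \<Longrightarrow> \<Union>\<G> \<subseteq> H \<Longrightarrow> H = carrier M"
    unfolding cgs_def by (rule finite_subfamily_generates[OF N]) (rule that)
  have "submodule U R M \<and> cofinitely_Rad_supplemented R (M\<lparr>carrier := U\<rparr>)" if "U \<in> \<G>" for U
    using that crs by blast
  from Rad_supplement_if_generated[OF fin this N gen]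
  show "\<exists>L. Rad_supplement R M N L" .
qed

end

theorem theorem3p7:
  fixes R :: "('a, 'c) ring_scheme" and M :: "('a, 'b, 'm) module_scheme"
  assumes "left_module R M"
  shows "(cofinitely_Rad_supplemented R M \<longleftrightarrow>
            (\<forall>N. maximal_submodule R M N \<longrightarrow> (\<exists>L. Rad_supplement R M N L))) \<and>
         ((\<forall>N. maximal_submodule R M N \<longrightarrow> (\<exists>L. Rad_supplement R M N L)) \<longleftrightarrow>
            \<not> (\<exists>K. maximal_submodule R (quotient_module M (wLoc R M)) K)) \<and>
         (\<not> (\<exists>K. maximal_submodule R (quotient_module M (wLoc R M)) K) \<longleftrightarrow>
            \<not> (\<exists>K. maximal_submodule R (quotient_module M (cgs R M)) K))"
proof -
  interpret left_module R M by (rule assms)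
  have ab: "\<forall>N. maximal_submodule R M N \<longrightarrow> (\<exists>L. Rad_supplement R M N L)"
    if "cofinitely_Rad_supplemented R M"
    using that maximal_submodule_cofinite unfolding cofinitely_Rad_supplemented_def by blast
  have bc: "\<not> (\<exists>N. maximal_submodule R M N \<and> wLoc R M \<subseteq> N)"
    if "\<forall>N. maximal_submodule R M N \<longrightarrow> (\<exists>L. Rad_supplement R M N L)"
    using that Rad_supplement_imp_wLoc_not_subset by blast
  have cd: "\<not> (\<exists>N. maximal_submodule R M N \<and> cgs R M \<subseteq> N)"
    if "\<not> (\<exists>N. maximal_submodule R M N \<and> wLoc R M \<subseteq> N)"
    using that wLoc_subset_cgs by blast
  have da: "cofinitely_Rad_supplemented R M"
    if "\<not> (\<exists>N. maximal_submodule R M N \<and> cgs R M \<subseteq> N)"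
    using that cofinitely_Rad_supplemented_if_no_maximal_over_cgs by blast
  show ?thesis
    unfolding maximal_quotient_iff[OF wLoc_submodule] maximal_quotient_iff[OF cgs_submodule]
    using ab bc cd da by argo
qed

end
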